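(* Let $\mathbf{F}$ be a normed space of continuous functions over a topological space $X$, let $\mathbf{E}$ be a $1$-independent normed space of continuous functions over a topological space $Y$, and let $\Phi:Y\to X$ and $\omega:Y\to\mathbb{C}$ be such that $W_{\Phi,\omega}$ is a bounded linear operator from $\mathbf{F}$ into $\mathbf{E}$. Then: (i) If the adjoint $W_{\Phi,\omega}^{*}:\mathbf{E}^*\to\mathbf{F}^*$ is an injection, then $\omega$ does not vanish. (ii) If $\Phi$ has a dense image and $W_{\Phi,\omega}^{*}$ is an injection, then $W_{\Phi,\omega}$ is an injection. (iii) If $\mathbf{F}$ and $\mathbf{E}$ are Banach spaces and $\Phi$ has a dense image, then $W_{\Phi,\omega}^{*}$ is bounded from below if and only if $W_{\Phi,\omega}$ is a linear homeomorphism of $\mathbf{F}$ onto $\mathbf{E}$; and $W_{\Phi,\omega}^{*}$ is an isometry if and only if $W_{\Phi,\omega}$ is a unitary.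
   Context: All spaces are over $\mathbb{C}$. $\mathcal{C}(X)$ is the space of all continuous functions $X\to\mathbb{C}$ with the compact-open topology. A normed space of continuous functions (NSCF) over $X$ is a linear subspace $\mathbf{F}\subset\mathcal{C}(X)$ equipped with a norm (not necessarily complete) such that the inclusion $\mathbf{F}\to\mathcal{C}(X)$ is continuous. An NSCF $\mathbf{E}$ over $Y$ is $1$-independent if for every $y\in Y$ there is $f\in\mathbf{E}$ with $f(y)\neq 0$. For maps $\Phi:Y\to X$ and $\omega:Y\to\mathbb{C}$ (not assumed continuous), the weighted composition operator is $[W_{\Phi,\omega}f](y)=\omega(y)f(\Phi(y))$, $y\in Y$. A unitary is a surjective linear isometry. An operator $S$ is bounded from below if there is $c>0$ with $\|Sv\|\ge c\|v\|$ for all $v$. *)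

theory Defs
  imports "HOL-Analysis.Analysis" "HOL-Library.Function_Algebras"
begin

text \<open>
  A function on a topological space \<^term>\<open>X :: 'x topology\<close> is represented by a total function
  \<^typ>\<open>'x \<Rightarrow> complex\<close> that vanishes outside \<^term>\<open>topspace X\<close>. With this convention the vector
  space operations on functions are the pointwise operations on the type. Continuous linear
  functionals on such a space \<open>V\<close> are represented in the same way, by functions
  \<open>('x \<Rightarrow> complex) \<Rightarrow> complex\<close> vanishing outside \<open>V\<close>, so that the dual is again a space of
  complex-valued functions.
\<close>

definition cscale :: "complex \<Rightarrow> ('a \<Rightarrow> complex) \<Rightarrow> 'a \<Rightarrow> complex" where
  "cscale c f = (\<lambda>x. c * f x)"

global_interpretation cfun: vector_space "cscale :: complex \<Rightarrow> ('a \<Rightarrow> complex) \<Rightarrow> 'a \<Rightarrow> complex"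
  by unfold_locales (auto simp: cscale_def fun_eq_iff algebra_simps)

locale normed_function_space =
  fixes V :: "('a \<Rightarrow> complex) set" and N :: "('a \<Rightarrow> complex) \<Rightarrow> real"
  assumes subspace: "cfun.subspace V"
    and norm_nonneg: "f \<in> V \<Longrightarrow> 0 \<le> N f"
    and norm_eq_0_iff: "f \<in> V \<Longrightarrow> N f = 0 \<longleftrightarrow> f = 0"
    and norm_triangle: "f \<in> V \<Longrightarrow> g \<in> V \<Longrightarrow> N (f + g) \<le> N f + N g"
    and norm_cscale: "f \<in> V \<Longrightarrow> N (cscale c f) = cmod c * N f"

text \<open>
  The library's locale for metric spaces asks for nonnegativity and symmetry on the whole type,
  hence the case distinction: nothing is assumed about \<open>N\<close> outside \<open>V\<close>.
\<close>

definition norm_dist ::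
  "('a \<Rightarrow> complex) set \<Rightarrow> (('a \<Rightarrow> complex) \<Rightarrow> real) \<Rightarrow> ('a \<Rightarrow> complex) \<Rightarrow> ('a \<Rightarrow> complex) \<Rightarrow> real" where
  "norm_dist V N f g = (if f \<in> V \<and> g \<in> V then N (f - g) else 0)"

sublocale normed_function_space \<subseteq> Metric_space V "norm_dist V N"
proof
  fix f g h :: "'a \<Rightarrow> complex"
  have diff: "u - v \<in> V" if "u \<in> V" "v \<in> V" for u v
    using subspace that by (rule cfun.subspace_diff)
  show "0 \<le> norm_dist V N f g"
    using diff by (simp add: norm_dist_def norm_nonneg)
  have "N (f - g) = N (g - f)" if "f \<in> V" "g \<in> V"
  proof -
    have "f - g = cscale (-1) (g - f)"
      by (simp add: cscale_def fun_eq_iff)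
    then show ?thesis
      using norm_cscale[OF diff[OF that(2,1)], of "-1"] by simp
  qed
  then show "norm_dist V N f g = norm_dist V N g f"
    by (simp add: norm_dist_def)
  show "norm_dist V N f g = 0 \<longleftrightarrow> f = g" if "f \<in> V" "g \<in> V"
    using norm_eq_0_iff[OF diff[OF that]] that by (simp add: norm_dist_def)
  show "norm_dist V N f h \<le> norm_dist V N f g + norm_dist V N g h"
    if "f \<in> V" "g \<in> V" "h \<in> V"
    using norm_triangle[OF diff[OF that(1,2)] diff[OF that(2,3)]] that
    by (simp add: norm_dist_def)
qed

definition norm_topology ::
  "('a \<Rightarrow> complex) set \<Rightarrow> (('a \<Rightarrow> complex) \<Rightarrow> real) \<Rightarrow> ('a \<Rightarrow> complex) topology" where
  "norm_topology V N = Metric_space.mtopology V (norm_dist V N)"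

definition norm_complete ::
  "('a \<Rightarrow> complex) set \<Rightarrow> (('a \<Rightarrow> complex) \<Rightarrow> real) \<Rightarrow> bool" where
  "norm_complete V N \<longleftrightarrow> Metric_space.mcomplete V (norm_dist V N)"

definition continuous_functions :: "'x topology \<Rightarrow> ('x \<Rightarrow> complex) set" where
  "continuous_functions X = {f. continuous_map X euclidean f \<and> (\<forall>x. x \<notin> topspace X \<longrightarrow> f x = 0)}"

definition compact_open_topology :: "'x topology \<Rightarrow> ('x \<Rightarrow> complex) topology" where
  "compact_open_topology X = topology_generated_by
     {{f \<in> continuous_functions X. f ` K \<subseteq> U} | K U. compactin X K \<and> open U}"

lemma topspace_compact_open_topology:
  "topspace (compact_open_topology X) = continuous_functions X"
proof -
  have "continuous_functions X = {f \<in> continuous_functions X. f ` {} \<subseteq> UNIV}"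
    by simp
  then show ?thesis
    unfolding compact_open_topology_def topology_generated_by_topspace
    by (blast intro: compactin_empty open_UNIV)
qed

locale nscf = normed_function_space F N
  for X :: "'x topology" and F :: "('x \<Rightarrow> complex) set" and N :: "('x \<Rightarrow> complex) \<Rightarrow> real" +
  assumes subset_continuous: "F \<subseteq> continuous_functions X"
    and continuous_inclusion:
      "continuous_map (norm_topology F N) (compact_open_topology X) (\<lambda>f. f)"

definition one_independent :: "'y topology \<Rightarrow> ('y \<Rightarrow> complex) set \<Rightarrow> bool" where
  "one_independent Y E \<longleftrightarrow> (\<forall>y \<in> topspace Y. \<exists>f \<in> E. f y \<noteq> 0)"

definition weighted_composition ::
  "'y topology \<Rightarrow> ('y \<Rightarrow> 'x) \<Rightarrow> ('y \<Rightarrow> complex) \<Rightarrow> ('x \<Rightarrow> complex) \<Rightarrow> 'y \<Rightarrow> complex" where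
  "weighted_composition Y \<Phi> \<omega> f = (\<lambda>y. if y \<in> topspace Y then \<omega> y * f (\<Phi> y) else 0)"

text \<open>The parameter \<open>s\<close> is the scalar multiplication of the codomain.\<close>

definition clinear_on ::
  "('a \<Rightarrow> complex) set \<Rightarrow> (complex \<Rightarrow> 'w \<Rightarrow> 'w) \<Rightarrow> (('a \<Rightarrow> complex) \<Rightarrow> 'w::plus) \<Rightarrow> bool" where
  "clinear_on V s T \<longleftrightarrow>
     (\<forall>f\<in>V. \<forall>g\<in>V. T (f + g) = T f + T g) \<and> (\<forall>c. \<forall>f\<in>V. T (cscale c f) = s c (T f))"

definition bounded_operator ::
  "('a \<Rightarrow> complex) set \<Rightarrow> (('a \<Rightarrow> complex) \<Rightarrow> real) \<Rightarrow>
   ('b \<Rightarrow> complex) set \<Rightarrow> (('b \<Rightarrow> complex) \<Rightarrow> real) \<Rightarrow> (('a \<Rightarrow> complex) \<Rightarrow> 'b \<Rightarrow> complex) \<Rightarrow> bool" where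
  "bounded_operator V N V' N' T \<longleftrightarrow>
     T \<in> V \<rightarrow> V' \<and> clinear_on V cscale T \<and> (\<exists>C. \<forall>f\<in>V. N' (T f) \<le> C * N f)"

definition dual_space ::
  "('a \<Rightarrow> complex) set \<Rightarrow> (('a \<Rightarrow> complex) \<Rightarrow> real) \<Rightarrow> (('a \<Rightarrow> complex) \<Rightarrow> complex) set" where
  "dual_space V N = {\<phi>. clinear_on V (*) \<phi> \<and> (\<exists>C. \<forall>f\<in>V. cmod (\<phi> f) \<le> C * N f) \<and>
     (\<forall>f. f \<notin> V \<longrightarrow> \<phi> f = 0)}"

definition dual_norm ::
  "('a \<Rightarrow> complex) set \<Rightarrow> (('a \<Rightarrow> complex) \<Rightarrow> real) \<Rightarrow> (('a \<Rightarrow> complex) \<Rightarrow> complex) \<Rightarrow> real" where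
  "dual_norm V N \<phi> = (SUP f \<in> {f \<in> V. N f \<le> 1}. cmod (\<phi> f))"

definition adjoint_operator ::
  "('a \<Rightarrow> complex) set \<Rightarrow> (('a \<Rightarrow> complex) \<Rightarrow> 'b \<Rightarrow> complex) \<Rightarrow>
   (('b \<Rightarrow> complex) \<Rightarrow> complex) \<Rightarrow> ('a \<Rightarrow> complex) \<Rightarrow> complex" where
  "adjoint_operator V T \<phi> = (\<lambda>f. if f \<in> V then \<phi> (T f) else 0)"

definition bounded_from_below ::
  "('a \<Rightarrow> complex) set \<Rightarrow> (('a \<Rightarrow> complex) \<Rightarrow> real) \<Rightarrow>
   (('b \<Rightarrow> complex) \<Rightarrow> real) \<Rightarrow> (('a \<Rightarrow> complex) \<Rightarrow> 'b \<Rightarrow> complex) \<Rightarrow> bool" where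
  "bounded_from_below V N N' T \<longleftrightarrow> (\<exists>c>0. \<forall>f\<in>V. N' (T f) \<ge> c * N f)"

definition linear_isometry ::
  "('a \<Rightarrow> complex) set \<Rightarrow> (('a \<Rightarrow> complex) \<Rightarrow> real) \<Rightarrow>
   (('b \<Rightarrow> complex) \<Rightarrow> real) \<Rightarrow> (('a \<Rightarrow> complex) \<Rightarrow> 'b \<Rightarrow> complex) \<Rightarrow> bool" where
  "linear_isometry V N N' T \<longleftrightarrow> clinear_on V cscale T \<and> (\<forall>f\<in>V. N' (T f) = N f)"

definition unitary_operator ::
  "('a \<Rightarrow> complex) set \<Rightarrow> (('a \<Rightarrow> complex) \<Rightarrow> real) \<Rightarrow>
   ('b \<Rightarrow> complex) set \<Rightarrow> (('b \<Rightarrow> complex) \<Rightarrow> real) \<Rightarrow> (('a \<Rightarrow> complex) \<Rightarrow> 'b \<Rightarrow> complex) \<Rightarrow> bool" where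
  "unitary_operator V N V' N' T \<longleftrightarrow> linear_isometry V N N' T \<and> T ` V = V'"

definition linear_homeomorphism ::
  "('a \<Rightarrow> complex) set \<Rightarrow> (('a \<Rightarrow> complex) \<Rightarrow> real) \<Rightarrow>
   ('b \<Rightarrow> complex) set \<Rightarrow> (('b \<Rightarrow> complex) \<Rightarrow> real) \<Rightarrow> (('a \<Rightarrow> complex) \<Rightarrow> 'b \<Rightarrow> complex) \<Rightarrow> bool" where
  "linear_homeomorphism V N V' N' T \<longleftrightarrow>
     clinear_on V cscale T \<and> homeomorphic_map (norm_topology V N) (norm_topology V' N') T"

end

theory Submission
  imports Defs
begin

text \<open>
  Everything rests on two observations about the functions themselves and on a quantitative
  duality principle for bounded operators.

  Point evaluations are bounded functionals (\<open>point_evaluation_in_dual_space\<close>), and the adjoint of a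
  weighted composition operator sends the evaluation at \<open>y\<close> to \<open>\<omega> y\<close> times the evaluation at
  \<open>\<Phi> y\<close>. If \<open>\<omega> y = 0\<close>, the adjoint therefore kills the evaluation at \<open>y\<close>, which is nonzero by
  1-independence. So an injective adjoint makes \<open>\<omega>\<close> nowhere zero; then \<open>W f = 0\<close> says that \<open>f\<close>
  vanishes on the image of \<open>\<Phi>\<close>, and continuity together with density gives \<open>f = 0\<close>.

  The duality principle is: if the adjoint of \<open>T\<close> is bounded from below by \<open>c > 0\<close> and the domain is
  complete, then for every \<open>M > 1 / c\<close> each \<open>g\<close> has a preimage of norm at most \<open>M\<close> times the norm
  of \<open>g\<close> (\<open>preimage_if_adjoint_bounded_from_below\<close>). Its proof applies the Hahn-Banach theorem to
  the inf-convolution of the two norms along \<open>T\<close>, which yields approximate preimages with the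
  right constant (\<open>approximate_preimage\<close>), and then sums a series of corrections. Combined with the
  injectivity obtained above, surjectivity with this norm control makes \<open>T\<close> a linear
  homeomorphism, and an isometry in the case \<open>c = 1\<close>. The converse directions are direct estimates.

  The Hahn-Banach theorem is proved here without extending functionals from subspaces: a minimal
  element among the sublinear functionals below a given one is automatically real-linear.
\<close>

section \<open>The Hahn-Banach theorem for seminorms\<close>

text \<open>
  One predicate covers the two notions that are needed: for \<open>S = UNIV\<close> it says that \<open>q\<close> is a
  seminorm on \<open>V\<close>, for \<open>S\<close> the nonnegative reals that \<open>q\<close> is a real sublinear functional. Only an
  inequality is asked for in the homogeneity condition, because that is what survives an infimum;
  for nonzero scalars whose inverse lies in \<open>S\<close>, equality follows.
\<close>

definition sublinear_on ::
  "complex set \<Rightarrow> ('a \<Rightarrow> complex) set \<Rightarrow> (('a \<Rightarrow> complex) \<Rightarrow> real) \<Rightarrow> bool" where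
  "sublinear_on S V q \<longleftrightarrow>
     (\<forall>f\<in>V. \<forall>g\<in>V. q (f + g) \<le> q f + q g) \<and> (\<forall>c\<in>S. \<forall>f\<in>V. q (cscale c f) \<le> cmod c * q f)"

abbreviation nonneg_scalars :: "complex set" where
  "nonneg_scalars \<equiv> of_real ` {0..}"

lemma sublinear_onD_add:
  "sublinear_on S V q \<Longrightarrow> f \<in> V \<Longrightarrow> g \<in> V \<Longrightarrow> q (f + g) \<le> q f + q g"
  by (simp add: sublinear_on_def)

lemma sublinear_onD_scale:
  "sublinear_on S V q \<Longrightarrow> c \<in> S \<Longrightarrow> f \<in> V \<Longrightarrow> q (cscale c f) \<le> cmod c * q f"
  by (simp add: sublinear_on_def)

lemma sublinear_on_mono: "sublinear_on S V q \<Longrightarrow> S' \<subseteq> S \<Longrightarrow> sublinear_on S' V q"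
  by (auto simp: sublinear_on_def)

lemma sublinear_on_zero:
  assumes "sublinear_on S V q" "0 \<in> S" "cfun.subspace V"
  shows "q 0 = 0"
proof -
  have 0: "(0 :: 'a \<Rightarrow> complex) \<in> V"
    using assms(3) by (rule cfun.subspace_0)
  have "q 0 \<le> 0"
    using sublinear_onD_scale[OF assms(1,2) 0] by simp
  moreover have "q 0 \<le> q 0 + q 0"
    using sublinear_onD_add[OF assms(1) 0 0] by simp
  ultimately show ?thesis by simp
qed

lemma sublinear_on_minus:
  assumes "sublinear_on S V q" "0 \<in> S" "cfun.subspace V" "f \<in> V"
  shows "- q (- f) \<le> q f"
  using sublinear_onD_add[OF assms(1,4) cfun.subspace_neg[OF assms(3,4)]]
    sublinear_on_zero[OF assms(1-3)] by simp

text \<open>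
  All sublinear functionals below are built as infima of families that are sublinear only jointly:
  a competitor for \<open>f + g\<close> can be assembled from one for \<open>f\<close> and one for \<open>g\<close>. This covers the
  infimum of a chain, the directional reduction of a sublinear functional, and the inf-convolution
  of two seminorms.
\<close>

lemma sublinear_on_INF:
  assumes sub: "cfun.subspace V" and ne: "I \<noteq> {}"
    and bdd: "\<And>f. f \<in> V \<Longrightarrow> bdd_below ((\<lambda>i. h i f) ` I)"
    and add: "\<And>i j f g. i \<in> I \<Longrightarrow> j \<in> I \<Longrightarrow> f \<in> V \<Longrightarrow> g \<in> V \<Longrightarrow> \<exists>k\<in>I. h k (f + g) \<le> h i f + h j g"
    and scale: "\<And>i c f. i \<in> I \<Longrightarrow> c \<in> S \<Longrightarrow> f \<in> V \<Longrightarrow> \<exists>k\<in>I. h k (cscale c f) \<le> cmod c * h i f"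
  shows "sublinear_on S V (\<lambda>f. INF i\<in>I. h i f)"
  unfolding sublinear_on_def
proof (intro conjI ballI)
  fix f g assume f: "f \<in> V" and g: "g \<in> V"
  have fg: "f + g \<in> V"
    using sub f g by (rule cfun.subspace_add)
  have *: "(INF i\<in>I. h i (f + g)) \<le> h i f + h j g" if ij: "i \<in> I" "j \<in> I" for i j
  proof -
    obtain k where "k \<in> I" "h k (f + g) \<le> h i f + h j g"
      using add[OF ij f g] by blast
    then show ?thesis
      using cINF_lower[OF bdd[OF fg]] order_trans by blast
  qed
  have "(INF i\<in>I. h i (f + g)) - h j g \<le> (INF i\<in>I. h i f)" if "j \<in> I" for j
    by (rule cINF_greatest[OF ne]) (use * that in \<open>simp add: algebra_simps\<close>)
  then have "(INF i\<in>I. h i (f + g)) - (INF i\<in>I. h i f) \<le> (INF i\<in>I. h i g)"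
    by (intro cINF_greatest[OF ne]) (simp add: algebra_simps)
  then show "(INF i\<in>I. h i (f + g)) \<le> (INF i\<in>I. h i f) + (INF i\<in>I. h i g)"
    by simp
next
  fix c f assume c: "c \<in> S" and f: "f \<in> V"
  have cf: "cscale c f \<in> V"
    using sub f by (rule cfun.subspace_scale)
  have *: "(INF i\<in>I. h i (cscale c f)) \<le> cmod c * h i f" if i: "i \<in> I" for i
  proof -
    obtain k where "k \<in> I" "h k (cscale c f) \<le> cmod c * h i f"
      using scale[OF i c f] by blast
    then show ?thesis
      using cINF_lower[OF bdd[OF cf]] order_trans by blast
  qed
  show "(INF i\<in>I. h i (cscale c f)) \<le> cmod c * (INF i\<in>I. h i f)"
  proof (cases "c = 0")
    case True
    then show ?thesis using * ne by auto
  next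
    case False
    have "(INF i\<in>I. h i (cscale c f)) / cmod c \<le> (INF i\<in>I. h i f)"
      by (rule cINF_greatest[OF ne]) (use * False in \<open>simp add: field_simps\<close>)
    then show ?thesis using False by (simp add: field_simps)
  qed
qed

text \<open>
  The functional \<open>q'\<close> is \<open>f \<mapsto> inf (q (f + t x) - t q x)\<close> over \<open>t \<ge> 0\<close>; the two upper bounds are the
  competitors \<open>t = 0\<close> and \<open>t = 1\<close>. The second one is what forces a minimal sublinear functional to
  be additive.
\<close>

lemma sublinear_on_reduce:
  assumes sub: "cfun.subspace V" and q: "sublinear_on nonneg_scalars V q" and x: "x \<in> V"
  obtains q' where "sublinear_on nonneg_scalars V q'"
    "\<And>f. f \<in> V \<Longrightarrow> q' f \<le> q f" "\<And>f. f \<in> V \<Longrightarrow> q' f \<le> q (f + x) - q x"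
proof -
  define h where "h t f = q (f + cscale (of_real t) x) - t * q x" for t :: real and f
  have tx: "cscale (of_real t) x \<in> V" for t :: real
    using sub x by (rule cfun.subspace_scale)
  have low: "- q (- f) \<le> h t f" if "f \<in> V" "t \<ge> 0" for f t
  proof -
    have V: "- f \<in> V" "f + cscale (of_real t) x \<in> V"
      using sub tx that by (auto intro: cfun.subspace_neg cfun.subspace_add)
    have "q (cscale (of_real t) x) \<le> q (f + cscale (of_real t) x) + q (- f)"
      using sublinear_onD_add[OF q V(2,1)] by simp
    moreover have "t * q x = q (cscale (of_real t) x)"
    proof (rule antisym)
      show "q (cscale (of_real t) x) \<le> t * q x"
        using sublinear_onD_scale[OF q _ x, of "of_real t"] that by simp
      show "t * q x \<le> q (cscale (of_real t) x)"
      proof (cases "t = 0")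
        case True
        have "q 0 = 0" using sublinear_on_zero[OF q _ sub] by force
        then show ?thesis using True by simp
      next
        case False
        have "q (cscale (of_real (1 / t)) (cscale (of_real t) x)) \<le> 1 / t * q (cscale (of_real t) x)"
          using sublinear_onD_scale[OF q _ tx, of "of_real (1 / t)"] that
          by (simp add: norm_divide image_iff del: of_real_divide)
        moreover have "cscale (of_real (1 / t)) (cscale (of_real t) x) = x"
          using False by (simp add: cscale_def fun_eq_iff)
        ultimately show ?thesis using False that by (simp add: field_simps)
      qed
    qed
    ultimately show ?thesis by (simp add: h_def)
  qed
  then have bdd: "bdd_below ((\<lambda>t. h t f) ` {0..})" if "f \<in> V" for f
    using that by (auto intro!: bdd_belowI[of _ "- q (- f)"])
  have lin: "sublinear_on nonneg_scalars V (\<lambda>f. INF t\<in>{0..}. h t f)"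
  proof (rule sublinear_on_INF[OF sub _ bdd])
    show "\<exists>k\<in>{0..}. h k (f + g) \<le> h s f + h t g"
      if "s \<in> {0..}" "t \<in> {0..}" "f \<in> V" "g \<in> V" for s t f g
    proof
      have "f + g + cscale (of_real (s + t)) x
          = (f + cscale (of_real s) x) + (g + cscale (of_real t) x)"
        by (simp add: cscale_def fun_eq_iff algebra_simps)
      then show "h (s + t) (f + g) \<le> h s f + h t g"
        using sublinear_onD_add[OF q cfun.subspace_add[OF sub that(3) tx]
            cfun.subspace_add[OF sub that(4) tx], of s t]
        by (simp add: h_def algebra_simps)
    qed (use that in auto)
    show "\<exists>k\<in>{0..}. h k (cscale c f) \<le> cmod c * h t f"
      if "t \<in> {0..}" "c \<in> nonneg_scalars" "f \<in> V" for t c f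
    proof
      from that(2) obtain r where r: "c = of_real r" "0 \<le> r" by auto
      have "cscale c f + cscale (of_real (r * t)) x = cscale c (f + cscale (of_real t) x)"
        using r by (simp add: cscale_def fun_eq_iff algebra_simps)
      then show "h (cmod c * t) (cscale c f) \<le> cmod c * h t f"
        using sublinear_onD_scale[OF q that(2) cfun.subspace_add[OF sub that(3) tx], of t] r
        by (simp add: h_def algebra_simps)
    qed (use that in auto)
  qed auto
  have "(INF t\<in>{0..}. h t f) \<le> q f" if "f \<in> V" for f
    using cINF_lower[OF bdd[OF that], of 0] by (simp add: h_def)
  moreover have "(INF t\<in>{0..}. h t f) \<le> q (f + x) - q x" if "f \<in> V" for f
    using cINF_lower[OF bdd[OF that], of 1] by (simp add: h_def)
  ultimately show thesis
    using that lin by blast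
qed

text \<open>
  Zorn's lemma applies downwards because \<open>- p (- f)\<close> bounds every sublinear functional below \<open>p\<close>
  from below at \<open>f\<close>, so a chain has a pointwise infimum.
\<close>

lemma minimal_sublinear_exists:
  assumes sub: "cfun.subspace V" and p: "sublinear_on nonneg_scalars V p"
  obtains q where "sublinear_on nonneg_scalars V q" "\<And>f. f \<in> V \<Longrightarrow> q f \<le> p f"
    "\<forall>q'. sublinear_on nonneg_scalars V q' \<and> (\<forall>f\<in>V. q' f \<le> q f) \<longrightarrow> (\<forall>f\<in>V. q' f = q f)"
proof -
  \<comment> \<open>Values off \<open>V\<close> are set to zero, so that the pointwise order is antisymmetric on \<open>A\<close>.\<close>
  define A where "A = {q. sublinear_on nonneg_scalars V q \<and> (\<forall>f\<in>V. q f \<le> p f) \<and>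
    (\<forall>f. f \<notin> V \<longrightarrow> q f = 0)}"
  have restrict: "(\<lambda>f. if f \<in> V then q f else 0) \<in> A"
    if "sublinear_on nonneg_scalars V q" "\<And>f. f \<in> V \<Longrightarrow> q f \<le> p f" for q
    using that sub by (auto simp: A_def sublinear_on_def cfun.subspace_add cfun.subspace_scale)
  have po: "partial_order_on A (relation_of (\<ge>) A)"
    by (auto simp: partial_order_on_def preorder_on_def refl_on_def relation_of_def
        trans_def antisym_def)
  have "\<exists>u\<in>A. \<forall>a\<in>C. u \<le> a" if C: "C \<in> Chains (relation_of (\<ge>) A)" for C
  proof (cases "C = {}")
    case True
    then show ?thesis using restrict[OF p] by blast
  next
    case False
    have CA: "C \<subseteq> A" and tot: "\<And>a b. a \<in> C \<Longrightarrow> b \<in> C \<Longrightarrow> a \<le> b \<or> b \<le> a"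
      using C by (auto simp: Chains_def relation_of_def)
    have Cq: "sublinear_on nonneg_scalars V q" "\<And>f. f \<in> V \<Longrightarrow> q f \<le> p f" if "q \<in> C" for q
      using CA that by (auto simp: A_def)
    have "- p (- f) \<le> q f" if "f \<in> V" "q \<in> C" for f q
      using sublinear_on_minus[OF Cq(1)[OF that(2)] _ sub that(1)]
        Cq(2)[OF that(2) cfun.subspace_neg[OF sub that(1)]] by force
    then have bdd: "bdd_below ((\<lambda>q. q f) ` C)" if "f \<in> V" for f
      using that by (auto intro!: bdd_belowI[of _ "- p (- f)"])
    define u where "u f = (INF q\<in>C. q f)" for f
    have u_le: "u f \<le> q f" if "q \<in> C" "f \<in> V" for q f
      unfolding u_def using cINF_lower[OF bdd] that by blast
    have "sublinear_on nonneg_scalars V u"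
      unfolding u_def
    proof (rule sublinear_on_INF[OF sub False bdd])
      show "\<exists>k\<in>C. k (f + g) \<le> i f + j g" if "i \<in> C" "j \<in> C" "f \<in> V" "g \<in> V" for i j f g
        using tot[OF that(1,2)]
      proof
        assume "i \<le> j"
        then have "i (f + g) \<le> i f + j g"
          using sublinear_onD_add[OF Cq(1)[OF that(1)] that(3,4)] le_funD[of i j g] by fastforce
        then show ?thesis using that by blast
      next
        assume "j \<le> i"
        then have "j (f + g) \<le> i f + j g"
          using sublinear_onD_add[OF Cq(1)[OF that(2)] that(3,4)] le_funD[of j i f] by fastforce
        then show ?thesis using that by blast
      qed
      show "\<exists>k\<in>C. k (cscale c f) \<le> cmod c * q f"
        if "q \<in> C" "c \<in> nonneg_scalars" "f \<in> V" for q c f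
        using sublinear_onD_scale[OF Cq(1)[OF that(1)] that(2,3)] that(1) by blast
    qed
    moreover have "u f \<le> p f" if "f \<in> V" for f
      using False u_le Cq(2) that by (meson ex_in_conv order_trans)
    ultimately have "(\<lambda>f. if f \<in> V then u f else 0) \<in> A"
      by (rule restrict)
    moreover have "(\<lambda>f. if f \<in> V then u f else 0) \<le> q" if "q \<in> C" for q
      using that u_le CA by (auto simp: le_fun_def A_def)
    ultimately show ?thesis by blast
  qed
  then obtain m where m: "m \<in> A" and min: "\<forall>a\<in>A. a \<le> m \<longrightarrow> a = m"
    using predicate_Zorn[OF po] by blast
  show thesis
  proof
    show "sublinear_on nonneg_scalars V m" "\<And>f. f \<in> V \<Longrightarrow> m f \<le> p f"
      using m by (auto simp: A_def)
    have "q' f = m f"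
      if q': "sublinear_on nonneg_scalars V q'" "\<forall>f\<in>V. q' f \<le> m f" and f: "f \<in> V" for q' f
    proof -
      have "(\<lambda>f. if f \<in> V then q' f else 0) \<in> A"
        using m q' by (intro restrict) (auto simp: A_def intro: order_trans)
      moreover have "(\<lambda>f. if f \<in> V then q' f else 0) \<le> m"
        using m q' by (auto simp: le_fun_def A_def)
      ultimately have "(\<lambda>f. if f \<in> V then q' f else 0) = m"
        using min by blast
      then show ?thesis using f by auto
    qed
    then show "\<forall>q'. sublinear_on nonneg_scalars V q' \<and> (\<forall>f\<in>V. q' f \<le> m f) \<longrightarrow>
        (\<forall>f\<in>V. q' f = m f)"
      by blast
  qed
qed

text \<open>
  A minimal sublinear functional \<open>u\<close> equals its own reduction in every direction \<open>h\<close>, hence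
  \<open>u f \<le> u (f + h) - u h\<close>, which together with subadditivity makes it additive. Reducing \<open>p\<close> in the
  direction \<open>g\<close> before minimising forces \<open>u (- g) \<le> - p g\<close>, and this makes \<open>u\<close> attain \<open>p\<close> at \<open>g\<close>.
\<close>

lemma real_linear_below_sublinear:
  assumes sub: "cfun.subspace V" and p: "sublinear_on nonneg_scalars V p" and g: "g \<in> V"
  obtains u where "\<And>f h. f \<in> V \<Longrightarrow> h \<in> V \<Longrightarrow> u (f + h) = u f + u h"
    "\<And>t f. f \<in> V \<Longrightarrow> u (cscale (of_real t) f) = t * u f"
    "\<And>f. f \<in> V \<Longrightarrow> u f \<le> p f" "u g = p g"
proof -
  have 0: "(0 :: complex) \<in> nonneg_scalars" by force
  obtain p' where p': "sublinear_on nonneg_scalars V p'" "\<And>f. f \<in> V \<Longrightarrow> p' f \<le> p f"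
    and p'_g: "\<And>f. f \<in> V \<Longrightarrow> p' f \<le> p (f + g) - p g"
    using that by (rule sublinear_on_reduce[OF sub p g])
  obtain u where u: "sublinear_on nonneg_scalars V u" and u_le: "\<And>f. f \<in> V \<Longrightarrow> u f \<le> p' f"
    and min: "\<forall>q'. sublinear_on nonneg_scalars V q' \<and> (\<forall>f\<in>V. q' f \<le> u f) \<longrightarrow>
      (\<forall>f\<in>V. q' f = u f)"
    using that by (rule minimal_sublinear_exists[OF sub p'(1)])
  have add: "u (f + h) = u f + u h" if f: "f \<in> V" and h: "h \<in> V" for f h
  proof -
    obtain q' where q'_lin: "sublinear_on nonneg_scalars V q'" "\<And>f. f \<in> V \<Longrightarrow> q' f \<le> u f"
      and q': "\<And>f. f \<in> V \<Longrightarrow> q' f \<le> u (f + h) - u h"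
      using that by (rule sublinear_on_reduce[OF sub u h])
    have "u f \<le> u (f + h) - u h"
      using min q'_lin q'[OF f] f by auto
    then show ?thesis
      using sublinear_onD_add[OF u f h] by simp
  qed
  have u0: "u 0 = 0"
    by (rule sublinear_on_zero[OF u 0 sub])
  have neg: "u (- f) = - u f" if "f \<in> V" for f
    using add[OF that cfun.subspace_neg[OF sub that]] u0 by simp
  have pos: "u (cscale (of_real t) f) = t * u f" if f: "f \<in> V" and t: "0 \<le> t" for t f
  proof (rule antisym)
    have le: "u (cscale (of_real t) f) \<le> t * u f" if "f \<in> V" for f
      using sublinear_onD_scale[OF u _ that, of "of_real t"] t by simp
    then show "u (cscale (of_real t) f) \<le> t * u f" using f .
    have "cscale (of_real t) (- f) = - cscale (of_real t) f"
      by (simp add: cscale_def fun_eq_iff)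
    then show "t * u f \<le> u (cscale (of_real t) f)"
      using le[OF cfun.subspace_neg[OF sub f]] neg[OF f] neg[OF cfun.subspace_scale[OF sub f]] by simp
  qed
  have scale: "u (cscale (of_real t) f) = t * u f" if f: "f \<in> V" for t f
  proof (cases "0 \<le> t")
    case False
    have "cscale (of_real t) f = - cscale (of_real (- t)) f"
      by (simp add: cscale_def fun_eq_iff)
    then show ?thesis
      using pos[OF f, of "- t"] neg[OF cfun.subspace_scale[OF sub f]] False by simp
  qed (use pos f in blast)
  have ng: "- g \<in> V" using sub g by (rule cfun.subspace_neg)
  have "p 0 = 0" by (rule sublinear_on_zero[OF p 0 sub])
  then have "u (- g) \<le> - p g"
    using u_le[OF ng] p'_g[OF ng] by simp
  then have "u g = p g"
    using neg[OF g] u_le[OF g] p'(2)[OF g] by simp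
  moreover have "u f \<le> p f" if "f \<in> V" for f
    using u_le p'(2) that order_trans by blast
  ultimately show thesis
    using that[of u] add scale by blast
qed

text \<open>
  The complex functional is recovered from its real part \<open>u\<close> as \<open>u f - i u (i f)\<close>. Rotating \<open>f\<close> so
  that the value becomes real and nonnegative turns the bound \<open>u \<le> p\<close> into a bound on the modulus.
\<close>

theorem Hahn_Banach_seminorm:
  assumes sub: "cfun.subspace V" and p: "sublinear_on UNIV V p" and g: "g \<in> V"
  obtains \<phi> where "clinear_on V (*) \<phi>" "\<And>f. f \<in> V \<Longrightarrow> cmod (\<phi> f) \<le> p f" "cmod (\<phi> g) = p g"
    "\<And>f. f \<notin> V \<Longrightarrow> \<phi> f = 0"
proof -
  obtain u where add: "\<And>f h. f \<in> V \<Longrightarrow> h \<in> V \<Longrightarrow> u (f + h) = u f + u h"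
    and scale: "\<And>t f. f \<in> V \<Longrightarrow> u (cscale (of_real t) f) = t * u f"
    and le: "\<And>f. f \<in> V \<Longrightarrow> u f \<le> p f" and ug: "u g = p g"
    using that by (rule real_linear_below_sublinear[OF sub sublinear_on_mono[OF p subset_UNIV] g])
  define \<phi> where "\<phi> f = (if f \<in> V then Complex (u f) (- u (cscale \<i> f)) else 0)" for f
  have cs: "cscale c f \<in> V" if "f \<in> V" for c f
    using sub that by (rule cfun.subspace_scale)
  have lin: "clinear_on V (*) \<phi>"
    unfolding clinear_on_def
  proof (intro conjI ballI allI)
    fix f h assume f: "f \<in> V" and h: "h \<in> V"
    have "cscale \<i> (f + h) = cscale \<i> f + cscale \<i> h"
      by (simp add: cscale_def fun_eq_iff algebra_simps)
    then show "\<phi> (f + h) = \<phi> f + \<phi> h"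
      using f h cs cfun.subspace_add[OF sub f h] by (simp add: \<phi>_def add complex_eq_iff)
  next
    fix c f assume f: "f \<in> V"
    have 1: "cscale c f = cscale (of_real (Re c)) f + cscale (of_real (Im c)) (cscale \<i> f)"
      by (simp add: cscale_def fun_eq_iff complex_eq_iff)
    have 2: "cscale \<i> (cscale c f) = cscale (of_real (Re c)) (cscale \<i> f) + cscale (of_real (- Im c)) f"
      by (simp add: cscale_def fun_eq_iff complex_eq_iff)
    have "u (cscale c f) = Re c * u f + Im c * u (cscale \<i> f)"
      using f cs by (subst 1) (simp only: add scale)
    moreover have "u (cscale \<i> (cscale c f)) = Re c * u (cscale \<i> f) + (- Im c) * u f"
      using f cs by (subst 2) (simp only: add scale)
    ultimately show "\<phi> (cscale c f) = c * \<phi> f"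
      using f cs by (simp add: \<phi>_def complex_eq_iff)
  qed
  have bound: "cmod (\<phi> f) \<le> p f" if f: "f \<in> V" for f
  proof -
    have nonneg: "0 \<le> p f"
      using sublinear_on_minus[OF p _ sub f] sublinear_onD_scale[OF p _ f, of "-1"]
      by (simp add: cscale_def fun_Compl_def)
    define c where "c = cnj (sgn (\<phi> f))"
    have "c * \<phi> f = of_real (cmod (\<phi> f))"
    proof (cases "\<phi> f = 0")
      case False
      then show ?thesis
        using complex_norm_square[of "\<phi> f"]
        by (simp add: c_def sgn_div_norm scaleR_conv_of_real field_simps power2_eq_square)
    qed (simp add: c_def)
    then have "\<phi> (cscale c f) = of_real (cmod (\<phi> f))"
      using lin f by (simp add: clinear_on_def)
    then have "cmod (\<phi> f) = u (cscale c f)"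
      using cs[OF f] by (auto simp: \<phi>_def complex_eq_iff)
    also have "\<dots> \<le> cmod c * p f"
      using le[OF cs[OF f]] sublinear_onD_scale[OF p _ f] order_trans by blast
    also have "\<dots> \<le> 1 * p f"
      using nonneg by (intro mult_right_mono) (auto simp: c_def norm_sgn)
    finally show ?thesis by simp
  qed
  have "p g = Re (\<phi> g)" using ug g by (simp add: \<phi>_def)
  then have "cmod (\<phi> g) = p g"
    using bound[OF g] complex_Re_le_cmod[of "\<phi> g"] by simp
  then show thesis
    using that[of \<phi>] lin bound by (simp add: \<phi>_def)
qed

section \<open>Linear maps, dual norms and completeness\<close>

lemma clinear_on_add: "clinear_on V s T \<Longrightarrow> f \<in> V \<Longrightarrow> g \<in> V \<Longrightarrow> T (f + g) = T f + T g"
  by (simp add: clinear_on_def)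

lemma clinear_on_scale: "clinear_on V s T \<Longrightarrow> f \<in> V \<Longrightarrow> T (cscale c f) = s c (T f)"
  by (simp add: clinear_on_def)

lemma clinear_on_diff:
  fixes T :: "('a \<Rightarrow> complex) \<Rightarrow> 'w::ab_group_add"
  assumes "clinear_on V s T" "cfun.subspace V" "f \<in> V" "g \<in> V"
  shows "T (f - g) = T f - T g"
  using clinear_on_add[OF assms(1) cfun.subspace_diff[OF assms(2-4)] assms(4)] by simp

lemma clinear_on_zero:
  fixes T :: "('a \<Rightarrow> complex) \<Rightarrow> 'w::ab_group_add"
  assumes "clinear_on V s T" "cfun.subspace V"
  shows "T 0 = 0"
  using clinear_on_diff[OF assms cfun.subspace_0[OF assms(2)] cfun.subspace_0[OF assms(2)]] by simp

text \<open>
  The usual passage from continuity at zero to a global bound. Any \<open>f\<close> violating the bound could be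
  rescaled so that \<open>B f = 1\<close> while still \<open>A f < r\<close>.
\<close>

lemma homogeneous_bound:
  assumes sub: "cfun.subspace V"
    and A: "\<And>f. f \<in> V \<Longrightarrow> 0 \<le> A f" "\<And>c f. f \<in> V \<Longrightarrow> A (cscale c f) = cmod c * A f"
    and B: "\<And>f. f \<in> V \<Longrightarrow> 0 \<le> B f" "\<And>c f. f \<in> V \<Longrightarrow> B (cscale c f) = cmod c * B f"
    and less: "\<And>f. f \<in> V \<Longrightarrow> A f < r \<Longrightarrow> B f < 1" and r: "r > 0" and f: "f \<in> V"
  shows "B f \<le> 1 / r * A f"
proof (rule ccontr)
  assume "\<not> B f \<le> 1 / r * A f"
  then have *: "A f < r * B f" using r by (simp add: field_simps)
  then have pos: "0 < B f"
    using A(1)[OF f] r by (smt (verit) zero_less_mult_pos)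
  define g where "g = cscale (of_real (1 / B f)) f"
  have "A g = A f / B f" "B g = 1"
    using A(2)[OF f] B(2)[OF f] pos by (simp_all add: g_def norm_divide)
  moreover have "A f / B f < r"
    using * pos by (simp add: pos_divide_less_eq)
  moreover have "g \<in> V"
    unfolding g_def using sub f by (rule cfun.subspace_scale)
  ultimately show False
    using less[of g] by simp
qed

context normed_function_space
begin

lemma norm_zero: "N 0 = 0"
  using norm_eq_0_iff[of 0] cfun.subspace_0[OF subspace] by simp

lemma dual_space_bdd_above:
  assumes "\<phi> \<in> dual_space V N"
  shows "bdd_above ((\<lambda>f. cmod (\<phi> f)) ` {f \<in> V. N f \<le> 1})"
proof -
  obtain C where C: "\<And>f. f \<in> V \<Longrightarrow> cmod (\<phi> f) \<le> C * N f"
    using assms by (auto simp: dual_space_def)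
  have "cmod (\<phi> f) \<le> \<bar>C\<bar>" if "f \<in> V" "N f \<le> 1" for f
  proof -
    have "C * N f \<le> \<bar>C\<bar> * 1"
      using that norm_nonneg by (intro mult_mono) auto
    then show ?thesis using C[OF that(1)] by simp
  qed
  then show ?thesis by (auto intro!: bdd_aboveI[of _ "\<bar>C\<bar>"])
qed

lemma dual_norm_nonneg:
  assumes "\<phi> \<in> dual_space V N"
  shows "0 \<le> dual_norm V N \<phi>"
  unfolding dual_norm_def
  using cfun.subspace_0[OF subspace]
  by (intro cSUP_upper2[OF dual_space_bdd_above[OF assms], of 0]) (simp_all add: norm_zero)

lemma dual_norm_bound:
  assumes \<phi>: "\<phi> \<in> dual_space V N" and f: "f \<in> V"
  shows "cmod (\<phi> f) \<le> dual_norm V N \<phi> * N f"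
proof (cases "f = 0")
  case True
  then show ?thesis
    using clinear_on_zero[OF _ subspace, of _ \<phi>] \<phi> by (auto simp: dual_space_def norm_zero)
next
  case False
  then have pos: "0 < N f"
    using norm_nonneg norm_eq_0_iff f by (simp add: less_le)
  define g where "g = cscale (of_real (1 / N f)) f"
  have "g \<in> V" "N g \<le> 1"
    using cfun.subspace_scale[OF subspace f] norm_cscale[OF f] pos by (simp_all add: g_def norm_divide)
  then have "cmod (\<phi> g) \<le> dual_norm V N \<phi>"
    unfolding dual_norm_def by (intro cSUP_upper dual_space_bdd_above[OF \<phi>]) auto
  moreover have "\<phi> g = of_real (1 / N f) * \<phi> f"
    using \<phi> f by (simp add: g_def dual_space_def clinear_on_def)
  ultimately show ?thesis
    using pos by (simp add: norm_mult norm_divide field_simps)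
qed

lemma dual_norm_le:
  assumes "0 \<le> C" "\<And>f. f \<in> V \<Longrightarrow> cmod (\<phi> f) \<le> C * N f"
  shows "dual_norm V N \<phi> \<le> C"
  unfolding dual_norm_def
proof (rule cSUP_least)
  show "{f \<in> V. N f \<le> 1} \<noteq> {}"
    using cfun.subspace_0[OF subspace] norm_zero by force
  show "cmod (\<phi> f) \<le> C" if "f \<in> {f \<in> V. N f \<le> 1}" for f
    using assms(2)[of f] mult_left_le[of "N f" C] that assms(1) by simp
qed

text \<open>
  The Hahn-Banach theorem for \<open>N\<close> itself. It serves to bound an operator by its adjoint.
\<close>

lemma norming_functional:
  assumes "f \<in> V"
  obtains \<phi> where "\<phi> \<in> dual_space V N" "dual_norm V N \<phi> \<le> 1" "cmod (\<phi> f) = N f"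
proof -
  have "sublinear_on UNIV V N"
    by (simp add: sublinear_on_def norm_triangle norm_cscale)
  then obtain \<phi> where \<phi>: "clinear_on V (*) \<phi>" "\<And>g. g \<in> V \<Longrightarrow> cmod (\<phi> g) \<le> N g"
      "cmod (\<phi> f) = N f" "\<And>g. g \<notin> V \<Longrightarrow> \<phi> g = 0"
    using Hahn_Banach_seminorm[OF subspace _ assms] by metis
  have "\<phi> \<in> dual_space V N"
    using \<phi> by (auto simp: dual_space_def intro!: exI[of _ 1])
  moreover have "dual_norm V N \<phi> \<le> 1"
    using \<phi>(2) by (intro dual_norm_le) auto
  ultimately show thesis using that \<phi>(3) by blast
qed

lemma norm_complete_limit:
  assumes "norm_complete V N" "\<And>n. S n \<in> V"
    and Cauchy: "\<forall>e>0. \<exists>n0. \<forall>m\<ge>n0. \<forall>n\<ge>n0. N (S m - S n) < e"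
  shows "\<exists>f\<in>V. (\<lambda>n. N (S n - f)) \<longlonglongrightarrow> 0"
proof -
  have "MCauchy S"
    using assms(2) Cauchy by (simp add: MCauchy_def norm_dist_def image_subset_iff)
  then obtain f where f: "limitin mtopology S f sequentially"
    using assms(1) by (auto simp: norm_complete_def mcomplete_def)
  then have fV: "f \<in> V" by (simp add: limitin_metric)
  have "(\<lambda>n. N (S n - f)) \<longlonglongrightarrow> 0"
  proof (rule tendstoI)
    fix e :: real assume "0 < e"
    then have "\<forall>\<^sub>F n in sequentially. norm_dist V N (S n) f < e"
      using f by (simp add: limitin_metric eventually_conj_iff)
    then show "\<forall>\<^sub>F n in sequentially. dist (N (S n - f)) 0 < e"
      using assms(2) fV norm_nonneg[OF cfun.subspace_diff[OF subspace]]
      by (simp add: norm_dist_def)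
  qed
  with fV show ?thesis by blast
qed

end

lemma Lipschitz_imp_continuous_map_norm_topology:
  assumes "normed_function_space V N" "normed_function_space V' N'"
    and T: "T \<in> V \<rightarrow> V'"
    and Lip: "\<And>f g. f \<in> V \<Longrightarrow> g \<in> V \<Longrightarrow> N' (T f - T g) \<le> C * N (f - g)"
  shows "continuous_map (norm_topology V N) (norm_topology V' N') T"
proof -
  interpret dom: normed_function_space V N by fact
  interpret cod: normed_function_space V' N' by fact
  have "\<exists>U. openin dom.mtopology U \<and> f \<in> U \<and> (\<forall>g\<in>U. T g \<in> cod.mball (T f) e)"
    if f: "f \<in> V" and e: "e > 0" for f e
  proof (intro exI conjI ballI)
    define r where "r = e / (\<bar>C\<bar> + 1)"
    show "f \<in> dom.mball f r"
      using f e by (simp add: r_def)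
    fix g assume g: "g \<in> dom.mball f r"
    then have gV: "g \<in> V" and "N (f - g) < e / (\<bar>C\<bar> + 1)"
      by (auto simp: norm_dist_def r_def)
    then have "N (f - g) * (\<bar>C\<bar> + 1) < e"
      by (simp add: pos_less_divide_eq)
    moreover have "C * N (f - g) \<le> N (f - g) * (\<bar>C\<bar> + 1)"
      using dom.norm_nonneg[OF cfun.subspace_diff[OF dom.subspace f gV]]
      by (subst mult.commute) (intro mult_left_mono; simp)
    ultimately show "T g \<in> cod.mball (T f) e"
      using Lip[OF f gV] f gV T by (auto simp: norm_dist_def)
  qed simp
  then show ?thesis
    unfolding norm_topology_def cod.continuous_map_to_metric by simp
qed

section \<open>Bounded operators and their adjoints\<close>

locale bounded_operator_between =
  dom: normed_function_space V N + cod: normed_function_space V' N'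
  for V :: "('a \<Rightarrow> complex) set" and N and V' :: "('b \<Rightarrow> complex) set" and N' +
  fixes T :: "('a \<Rightarrow> complex) \<Rightarrow> 'b \<Rightarrow> complex"
  assumes bounded: "bounded_operator V N V' N' T"
begin

lemma maps_to: "f \<in> V \<Longrightarrow> T f \<in> V'"
  and linear: "clinear_on V cscale T"
  using bounded by (auto simp: bounded_operator_def)

lemmas T_add = clinear_on_add[OF linear]
lemmas T_scale = clinear_on_scale[OF linear]
lemmas T_diff = clinear_on_diff[OF linear dom.subspace]
lemmas T_zero = clinear_on_zero[OF linear dom.subspace]

lemma bound_pos:
  obtains B where "B > 0" "\<And>f. f \<in> V \<Longrightarrow> N' (T f) \<le> B * N f"
proof -
  obtain C where C: "\<And>f. f \<in> V \<Longrightarrow> N' (T f) \<le> C * N f"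
    using bounded by (auto simp: bounded_operator_def)
  have "N' (T f) \<le> (\<bar>C\<bar> + 1) * N f" if "f \<in> V" for f
    using C[OF that] mult_right_mono[of C "\<bar>C\<bar> + 1" "N f"] dom.norm_nonneg[OF that] by linarith
  then show thesis using that[of "\<bar>C\<bar> + 1"] by simp
qed

lemma inj_on_iff_kernel_trivial: "inj_on T V \<longleftrightarrow> (\<forall>f\<in>V. T f = 0 \<longrightarrow> f = 0)"
proof
  assume inj: "inj_on T V"
  show "\<forall>f\<in>V. T f = 0 \<longrightarrow> f = 0"
    using inj_onD[OF inj, of _ 0] T_zero cfun.subspace_0[OF dom.subspace] by auto
next
  assume *: "\<forall>f\<in>V. T f = 0 \<longrightarrow> f = 0"
  show "inj_on T V"
  proof (rule inj_onI)
    fix f g assume "f \<in> V" "g \<in> V" "T f = T g"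
    then show "f = g"
      using * cfun.subspace_diff[OF dom.subspace, of f g] T_diff[of f g] by auto
  qed
qed

lemma adjoint_in_dual_space:
  assumes \<phi>: "\<phi> \<in> dual_space V' N'"
  shows "adjoint_operator V T \<phi> \<in> dual_space V N"
proof -
  have lin: "clinear_on V' (*) \<phi>" using \<phi> by (simp add: dual_space_def)
  obtain B where B: "B > 0" "\<And>f. f \<in> V \<Longrightarrow> N' (T f) \<le> B * N f"
    by (rule bound_pos) blast
  have "cmod (\<phi> (T f)) \<le> dual_norm V' N' \<phi> * B * N f" if "f \<in> V" for f
    using cod.dual_norm_bound[OF \<phi> maps_to[OF that]]
      mult_left_mono[OF B(2)[OF that] cod.dual_norm_nonneg[OF \<phi>]] by (simp add: mult.assoc)
  then have "\<exists>C. \<forall>f\<in>V. cmod (adjoint_operator V T \<phi> f) \<le> C * N f"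
    by (auto simp: adjoint_operator_def)
  then show ?thesis
    using cfun.subspace_add[OF dom.subspace] cfun.subspace_scale[OF dom.subspace]
      clinear_on_add[OF lin] clinear_on_scale[OF lin] T_add T_scale maps_to
    by (simp add: dual_space_def clinear_on_def adjoint_operator_def)
qed

lemma adjoint_linear: "clinear_on (dual_space V' N') cscale (adjoint_operator V T)"
  by (auto simp: clinear_on_def adjoint_operator_def cscale_def fun_eq_iff)

lemma inj_on_adjoint_if_bounded_from_below:
  assumes "bounded_from_below (dual_space V' N') (dual_norm V' N') (dual_norm V N)
    (adjoint_operator V T)"
  shows "inj_on (adjoint_operator V T) (dual_space V' N')"
proof (rule inj_onI)
  fix \<phi> \<psi> assume \<phi>: "\<phi> \<in> dual_space V' N'" and \<psi>: "\<psi> \<in> dual_space V' N'"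
    and eq: "adjoint_operator V T \<phi> = adjoint_operator V T \<psi>"
  obtain c where c: "c > 0" "\<And>\<theta>. \<theta> \<in> dual_space V' N' \<Longrightarrow>
      c * dual_norm V' N' \<theta> \<le> dual_norm V N (adjoint_operator V T \<theta>)"
    using assms by (auto simp: bounded_from_below_def)
  have "cmod (\<phi> g - \<psi> g) \<le> (dual_norm V' N' \<phi> + dual_norm V' N' \<psi>) * N' g" if "g \<in> V'" for g
    using cod.dual_norm_bound[OF \<phi> that] cod.dual_norm_bound[OF \<psi> that]
      norm_triangle_ineq4[of "\<phi> g" "\<psi> g"] by (simp add: algebra_simps)
  then have "\<exists>C. \<forall>g\<in>V'. cmod (\<phi> g - \<psi> g) \<le> C * N' g"
    by blast
  then have diff_dual: "\<phi> - \<psi> \<in> dual_space V' N'"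
    using \<phi> \<psi> by (simp add: dual_space_def clinear_on_def algebra_simps)
  have "adjoint_operator V T \<phi> f = adjoint_operator V T \<psi> f" for f
    using eq by simp
  then have "\<phi> (T f) = \<psi> (T f)" if "f \<in> V" for f
    using that unfolding adjoint_operator_def by metis
  then have "adjoint_operator V T (\<phi> - \<psi>) = 0"
    by (simp add: adjoint_operator_def fun_eq_iff)
  moreover have "dual_norm V N 0 \<le> 0"
    by (rule dom.dual_norm_le) auto
  ultimately have "c * dual_norm V' N' (\<phi> - \<psi>) \<le> 0"
    using c(2)[OF diff_dual] by simp
  then have norm_le: "dual_norm V' N' (\<phi> - \<psi>) \<le> 0"
    using c(1) by (simp add: mult_le_0_iff)
  have "\<phi> g = \<psi> g" for g
  proof (cases "g \<in> V'")
    case True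
    have "cmod ((\<phi> - \<psi>) g) \<le> 0"
      using cod.dual_norm_bound[OF diff_dual True]
        mult_right_mono[OF norm_le cod.norm_nonneg[OF True]] by linarith
    then show ?thesis by simp
  next
    case False
    then show ?thesis using \<phi> \<psi> by (simp add: dual_space_def)
  qed
  then show "\<phi> = \<psi>" by (rule ext)
qed

text \<open>
  The seminorm \<open>p u = inf (N f + K * N' (u - T f))\<close>, taken over \<open>f\<close>, measures how cheaply \<open>u\<close> can be
  approximated from the range of \<open>T\<close> when an error costs \<open>K\<close> per unit. It is dominated by \<open>K * N'\<close>,
  so a functional \<open>\<phi>\<close> with \<open>|\<phi>| \<le> p\<close> that attains \<open>p\<close> at \<open>g\<close> is bounded; and \<open>p (T f) \<le> N f\<close>,
  so its adjoint image has norm at most 1. The lower bound on the adjoint then gives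
  \<open>p g = |\<phi> g| \<le> N' g / c\<close>, independently of \<open>K\<close>. This replaces the separation of a point
  from the closure of the image of the unit ball.
\<close>

lemma approximate_preimage:
  assumes c: "c > 0"
    and below: "\<And>\<phi>. \<phi> \<in> dual_space V' N' \<Longrightarrow>
      c * dual_norm V' N' \<phi> \<le> dual_norm V N (adjoint_operator V T \<phi>)"
    and M: "1 / c < M" and K: "K > 0" and g: "g \<in> V'"
  obtains f where "f \<in> V" "N f + K * N' (g - T f) \<le> M * N' g"
proof (cases "g = 0")
  case True
  show thesis
    by (rule that[of 0])
      (use cfun.subspace_0[OF dom.subspace] T_zero True in \<open>auto simp: dom.norm_zero cod.norm_zero\<close>)
next
  case False
  have ne: "V \<noteq> {}" using cfun.subspace_0[OF dom.subspace] by auto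
  have in_V': "g - T f \<in> V'" if "g \<in> V'" "f \<in> V" for f g
    using that maps_to cfun.subspace_diff[OF cod.subspace] by auto
  define h where "h f g = N f + K * N' (g - T f)" for f g
  have h_nonneg: "0 \<le> h f g" if "f \<in> V" "g \<in> V'" for f g
    using that K in_V' by (simp add: h_def dom.norm_nonneg cod.norm_nonneg)
  then have bdd: "bdd_below ((\<lambda>f. h f g) ` V)" if "g \<in> V'" for g
    using that by (auto intro!: bdd_belowI[of _ 0])
  define p where "p g = (INF f\<in>V. h f g)" for g
  have "sublinear_on UNIV V' p"
    unfolding p_def
  proof (rule sublinear_on_INF[OF cod.subspace ne bdd])
    show "\<exists>k\<in>V. h k (u + v) \<le> h i u + h j v" if "i \<in> V" "j \<in> V" "u \<in> V'" "v \<in> V'" for i j u v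
    proof
      have "u + v - T (i + j) = (u - T i) + (v - T j)"
        unfolding T_add[OF that(1,2)] by (rule add_diff_add)
      then have "N' (u + v - T (i + j)) \<le> N' (u - T i) + N' (v - T j)"
        using cod.norm_triangle[OF in_V'[OF that(3,1)] in_V'[OF that(4,2)]] by metis
      then have "K * N' (u + v - T (i + j)) \<le> K * N' (u - T i) + K * N' (v - T j)"
        using K by (simp flip: distrib_left)
      then show "h (i + j) (u + v) \<le> h i u + h j v"
        using dom.norm_triangle[of i j] that by (simp add: h_def)
    qed (use that in \<open>auto intro: cfun.subspace_add[OF dom.subspace]\<close>)
    show "\<exists>k\<in>V. h k (cscale a u) \<le> cmod a * h i u" if "i \<in> V" "a \<in> UNIV" "u \<in> V'" for i a u
    proof
      have "cscale a u - T (cscale a i) = cscale a (u - T i)"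
        using T_scale that by (simp add: cfun.scale_right_diff_distrib)
      then have "N' (cscale a u - T (cscale a i)) = cmod a * N' (u - T i)"
        using cod.norm_cscale[OF in_V'[OF that(3,1)]] by metis
      then show "h (cscale a i) (cscale a u) \<le> cmod a * h i u"
        using dom.norm_cscale[OF that(1)] by (simp add: h_def distrib_left mult.left_commute)
    qed (use that in \<open>auto intro: cfun.subspace_scale[OF dom.subspace]\<close>)
  qed
  then obtain \<phi> where \<phi>: "clinear_on V' (*) \<phi>" "\<And>u. u \<in> V' \<Longrightarrow> cmod (\<phi> u) \<le> p u"
      "cmod (\<phi> g) = p g" "\<And>u. u \<notin> V' \<Longrightarrow> \<phi> u = 0"
    using Hahn_Banach_seminorm[OF cod.subspace _ g] by metis
  have p_le: "p u \<le> h f u" if "u \<in> V'" "f \<in> V" for u f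
    unfolding p_def using cINF_lower[OF bdd[OF that(1)] that(2)] .
  have "p u \<le> K * N' u" if "u \<in> V'" for u
    using p_le[OF that cfun.subspace_0[OF dom.subspace]] by (simp add: h_def T_zero dom.norm_zero)
  then have dual: "\<phi> \<in> dual_space V' N'"
    using \<phi> by (force simp: dual_space_def intro: order_trans)
  have "p (T f) \<le> N f" if "f \<in> V" for f
    using p_le[OF maps_to[OF that] that] by (simp add: h_def cod.norm_zero)
  then have "cmod (\<phi> (T f)) \<le> N f" if "f \<in> V" for f
    using \<phi>(2)[OF maps_to[OF that]] that by (meson order_trans)
  then have "dual_norm V N (adjoint_operator V T \<phi>) \<le> 1"
    by (intro dom.dual_norm_le) (auto simp: adjoint_operator_def)
  then have "dual_norm V' N' \<phi> \<le> 1 / c"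
    using below[OF dual] c by (simp add: field_simps)
  then have "p g \<le> 1 / c * N' g"
    using cod.dual_norm_bound[OF dual g] mult_right_mono[OF _ cod.norm_nonneg[OF g]] \<phi>(3)
    by (metis order_trans)
  moreover have "0 < N' g"
    using False cod.norm_nonneg[OF g] cod.norm_eq_0_iff[OF g] by simp
  ultimately have "p g < M * N' g"
    using M by (meson mult_strict_right_mono order_le_less_trans)
  then obtain f where "f \<in> V" "h f g < M * N' g"
    unfolding p_def using cINF_less_iff[OF ne bdd[OF g]] by blast
  then show thesis using that by (simp add: h_def)
qed

text \<open>
  The series argument from the proof of the open mapping theorem: solve approximately, replace the
  right-hand side by the error, and repeat. The corrections decay geometrically, so they sum up in
  the complete space \<open>V\<close>.
\<close>

lemma preimage_by_successive_approximation:
  assumes complete: "norm_complete V N" and M: "0 \<le> M" and \<delta>: "0 \<le> \<delta>" "\<delta> < 1"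
    and approx: "\<forall>g\<in>V'. \<exists>f\<in>V. N f \<le> M * N' g \<and> N' (g - T f) \<le> \<delta> * N' g"
    and g: "g \<in> V'"
  obtains f where "f \<in> V" "T f = g" "N f \<le> M / (1 - \<delta>) * N' g"
proof -
  obtain s where s: "\<And>u. u \<in> V' \<Longrightarrow> s u \<in> V" "\<And>u. u \<in> V' \<Longrightarrow> N (s u) \<le> M * N' u"
    "\<And>u. u \<in> V' \<Longrightarrow> N' (u - T (s u)) \<le> \<delta> * N' u"
    using approx by metis
  define r where "r n = ((\<lambda>u. u - T (s u)) ^^ n) g" for n
  have r_0: "r 0 = g" and r_Suc: "r (Suc n) = r n - T (s (r n))" for n
    by (simp_all add: r_def)
  have r_V': "r n \<in> V'" for n
  proof (induction n)
    case (Suc n)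
    show ?case
      unfolding r_Suc using cfun.subspace_diff[OF cod.subspace Suc maps_to[OF s(1)[OF Suc]]] .
  qed (simp add: r_0 g)
  have r_norm: "N' (r n) \<le> \<delta> ^ n * N' g" for n
  proof (induction n)
    case (Suc n)
    have "N' (r (Suc n)) \<le> \<delta> * N' (r n)"
      using s(3)[OF r_V'] by (simp add: r_Suc)
    also have "\<dots> \<le> \<delta> * (\<delta> ^ n * N' g)"
      using Suc \<delta> by (intro mult_left_mono) auto
    finally show ?case by (simp add: mult.assoc)
  qed (simp add: r_0)
  define S where "S n = (\<Sum>k<n. s (r k))" for n
  have S_Suc: "S (Suc n) = S n + s (r n)" and S_0: "S 0 = 0" for n
    by (simp_all add: S_def)
  have S_V: "S n \<in> V" for n
  proof (induction n)
    case 0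
    show ?case unfolding S_0 using cfun.subspace_0[OF dom.subspace] .
  next
    case (Suc n)
    show ?case
      unfolding S_Suc using cfun.subspace_add[OF dom.subspace Suc s(1)[OF r_V']] .
  qed
  have T_S: "T (S n) = g - r n" for n
  proof (induction n)
    case (Suc n)
    show ?case
      unfolding S_Suc r_Suc T_add[OF S_V s(1)[OF r_V']] Suc by (simp add: fun_eq_iff)
  qed (use T_zero in \<open>simp only: S_0 r_0 diff_self\<close>)
  \<comment> \<open>The tail \<open>b n\<close> of the geometric series that majorises the corrections from step \<open>n\<close> on.\<close>
  define b where "b n = M / (1 - \<delta>) * N' g * \<delta> ^ n" for n
  have b_0: "b 0 = M / (1 - \<delta>) * N' g"
    by (simp add: b_def)
  have b_nonneg: "0 \<le> b n" for n
    using M \<delta> cod.norm_nonneg[OF g] by (simp add: b_def)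
  have b_diff: "b n - b (Suc n) = M * (\<delta> ^ n * N' g)" for n
  proof -
    have "b n - b (Suc n) = M / (1 - \<delta>) * ((1 - \<delta>) * (\<delta> ^ n * N' g))"
      unfolding b_def by (simp only: power_Suc left_diff_distrib right_diff_distrib mult_ac mult_1)
    then show ?thesis using \<delta> by simp
  qed
  have S_diff: "N (S (n + k) - S n) \<le> b n - b (n + k)" for n k
  proof (induction k)
    case (Suc k)
    have "S (n + Suc k) - S n = (S (n + k) - S n) + s (r (n + k))"
      by (simp add: S_Suc)
    then have "N (S (n + Suc k) - S n) \<le> N (S (n + k) - S n) + N (s (r (n + k)))"
      using dom.norm_triangle[OF cfun.subspace_diff[OF dom.subspace S_V S_V] s(1)[OF r_V']] by metis
    moreover have "N (s (r (n + k))) \<le> M * (\<delta> ^ (n + k) * N' g)"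
      using s(2)[OF r_V'] mult_left_mono[OF r_norm M] by (rule order_trans)
    ultimately show ?case
      using Suc b_diff[of "n + k"] unfolding add_Suc_right by linarith
  qed (use dom.norm_zero in \<open>simp only: add_0_right diff_self order_refl\<close>)
  have S_diff_le: "N (S m - S n) \<le> b n" if "n \<le> m" for m n
    using S_diff[of n "m - n"] b_nonneg[of m] that by simp
  have b_lim: "b \<longlonglongrightarrow> 0"
    unfolding b_def[abs_def] by (intro tendsto_mult_right_zero LIMSEQ_realpow_zero \<delta>)
  have Cauchy: "\<forall>e>0. \<exists>n0. \<forall>m\<ge>n0. \<forall>n\<ge>n0. N (S m - S n) < e"
  proof (intro allI impI)
    fix e :: real assume e: "e > 0"
    obtain n0 where n0: "\<And>n. n \<ge> n0 \<Longrightarrow> b n < e"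
      using order_tendstoD(2)[OF b_lim e] by (auto simp: eventually_sequentially)
    have sym: "N (S m - S n) = N (S n - S m)" for m n
    proof -
      have "S m - S n = cscale (-1) (S n - S m)"
        by (simp add: cscale_def fun_eq_iff)
      then show ?thesis
        using dom.norm_cscale[OF cfun.subspace_diff[OF dom.subspace S_V S_V], of "-1" n m] by simp
    qed
    have "N (S m - S n) < e" if "m \<ge> n0" "n \<ge> n0" for m n
    proof (cases "n \<le> m")
      case True
      from S_diff_le[OF this] n0[OF that(2)] show ?thesis by (rule order_le_less_trans)
    next
      case False
      then have "N (S n - S m) \<le> b m" by (intro S_diff_le) simp
      from this n0[OF that(1)] show ?thesis
        unfolding sym[of m n] by (rule order_le_less_trans)
    qed
    then show "\<exists>n0. \<forall>m\<ge>n0. \<forall>n\<ge>n0. N (S m - S n) < e" by blast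
  qed
  obtain f where f: "f \<in> V" and lim: "(\<lambda>n. N (S n - f)) \<longlonglongrightarrow> 0"
    using dom.norm_complete_limit[OF complete S_V Cauchy] by blast
  obtain B where B: "B > 0" "\<And>f. f \<in> V \<Longrightarrow> N' (T f) \<le> B * N f"
    by (rule bound_pos) blast
  have Sf: "S n - f \<in> V" for n
    using cfun.subspace_diff[OF dom.subspace S_V f] .
  have gTf: "g - T f \<in> V'"
    using cfun.subspace_diff[OF cod.subspace g maps_to[OF f]] .
  have residual: "N' (g - T f) \<le> B * N (S n - f) + \<delta> ^ n * N' g" for n
  proof -
    have eq: "T (S n - f) + r n = g - T f"
      by (simp add: T_diff[OF S_V f] T_S fun_eq_iff)
    show ?thesis
      using cod.norm_triangle[OF maps_to[OF Sf] r_V', of n n] B(2)[OF Sf, of n] r_norm[of n]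
      unfolding eq by linarith
  qed
  have "(\<lambda>n. B * N (S n - f) + \<delta> ^ n * N' g) \<longlonglongrightarrow> B * 0 + 0 * N' g"
    by (intro tendsto_intros lim LIMSEQ_realpow_zero \<delta>)
  then have "N' (g - T f) \<le> B * 0 + 0 * N' g"
    by (rule LIMSEQ_le_const) (use residual in blast)
  then have "T f = g"
    using cod.norm_nonneg[OF gTf] cod.norm_eq_0_iff[OF gTf] by simp
  moreover have "N f \<le> M / (1 - \<delta>) * N' g"
  proof (rule LIMSEQ_le_const)
    show "(\<lambda>n. N (S n - f) + b 0) \<longlonglongrightarrow> M / (1 - \<delta>) * N' g"
      using tendsto_add[OF lim tendsto_const[of "b 0"]] by (simp add: b_0)
    have "N f \<le> N (S n - f) + b 0" for n
    proof -
      have eq: "S n + cscale (-1) (S n - f) = f"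
        by (simp add: cscale_def fun_eq_iff)
      have "N f \<le> N (S n) + N (cscale (-1) (S n - f))"
        using dom.norm_triangle[OF S_V[of n] cfun.subspace_scale[OF dom.subspace Sf[of n], of "-1"]]
        unfolding eq .
      then show ?thesis
        using S_diff_le[of 0 n] dom.norm_cscale[OF Sf, of "-1" n] unfolding S_0 diff_0_right by simp
    qed
    then show "\<exists>n0. \<forall>n\<ge>n0. N f \<le> N (S n - f) + b 0" by blast
  qed
  ultimately show thesis using that f by blast
qed

text \<open>
  The constant \<open>M\<close> may be arbitrarily close to \<open>1 / c\<close>. For the isometry criterion, where
  \<open>c = 1\<close>, this sharpness is essential: surjectivity with some constant would not be enough.
\<close>

theorem preimage_if_adjoint_bounded_from_below:
  assumes complete: "norm_complete V N" and c: "c > 0"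
    and below: "\<And>\<phi>. \<phi> \<in> dual_space V' N' \<Longrightarrow>
      c * dual_norm V' N' \<phi> \<le> dual_norm V N (adjoint_operator V T \<phi>)"
    and M: "1 / c < M" and g: "g \<in> V'"
  obtains f where "f \<in> V" "T f = g" "N f \<le> M * N' g"
proof -
  obtain M1 where M1: "1 / c < M1" "M1 < M"
    using dense[OF M] by blast
  have pos: "0 < M1"
    using M1(1) c by (meson divide_pos_pos less_trans zero_less_one)
  \<comment> \<open>Chosen so that the loss \<open>1 / (1 - \<delta>)\<close> in the series turns \<open>M1\<close> into exactly \<open>M\<close>.\<close>
  define \<delta> where "\<delta> = 1 - M1 / M"
  have \<delta>: "0 < \<delta>" "\<delta> < 1" "M1 / (1 - \<delta>) = M"
    using pos M1(2) by (simp_all add: \<delta>_def field_simps)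
  have approx: "\<forall>u\<in>V'. \<exists>f\<in>V. N f \<le> M1 * N' u \<and> N' (u - T f) \<le> \<delta> * N' u"
  proof
    fix u assume u: "u \<in> V'"
    \<comment> \<open>At the penalty \<open>M1 / \<delta>\<close>, a total cost of \<open>M1 * N' u\<close> allows an error of at most \<open>\<delta> * N' u\<close>.\<close>
    obtain f where f: "f \<in> V" "N f + M1 / \<delta> * N' (u - T f) \<le> M1 * N' u"
      using approximate_preimage[OF c below M1(1) divide_pos_pos[OF pos \<delta>(1)] u] by blast
    have "0 \<le> N' (u - T f)"
      using cod.norm_nonneg[OF cfun.subspace_diff[OF cod.subspace u maps_to[OF f(1)]]] .
    then have "0 \<le> M1 / \<delta> * N' (u - T f)"
      using pos \<delta>(1) by simp
    moreover have "0 \<le> N f"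
      using dom.norm_nonneg[OF f(1)] .
    ultimately have "N f \<le> M1 * N' u" "M1 / \<delta> * N' (u - T f) \<le> M1 * N' u"
      using f(2) by linarith+
    moreover from this(2) have "N' (u - T f) \<le> \<delta> * N' u"
      using pos \<delta>(1) by (simp add: field_simps)
    ultimately show "\<exists>f\<in>V. N f \<le> M1 * N' u \<and> N' (u - T f) \<le> \<delta> * N' u"
      using f(1) by blast
  qed
  obtain f where "f \<in> V" "T f = g" "N f \<le> M1 / (1 - \<delta>) * N' g"
    using preimage_by_successive_approximation[OF complete less_imp_le[OF pos]
        less_imp_le[OF \<delta>(1)] \<delta>(2) approx g] by blast
  then show thesis
    using that unfolding \<delta>(3) by blast
qed

lemma linear_homeomorphism_iff:
  "linear_homeomorphism V N V' N' T \<longleftrightarrow> T ` V = V' \<and> (\<exists>M. \<forall>f\<in>V. N f \<le> M * N' (T f))"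
proof
  assume "linear_homeomorphism V N V' N' T"
  then have hom: "homeomorphic_map dom.mtopology cod.mtopology T"
    by (simp add: linear_homeomorphism_def norm_topology_def)
  then have onto: "T ` V = V'"
    using homeomorphic_imp_surjective_map by fastforce
  obtain G where G: "continuous_map cod.mtopology dom.mtopology G" "\<And>f. f \<in> V \<Longrightarrow> G (T f) = f"
    using hom by (auto simp: homeomorphic_map_maps homeomorphic_maps_def)
  have zero_V: "0 \<in> V" "0 \<in> V'"
    using cfun.subspace_0 dom.subspace cod.subspace by auto
  have G0: "G 0 = 0"
    using G(2)[OF zero_V(1)] by (simp add: T_zero)
  have "openin dom.mtopology (dom.mball 0 1)" "G 0 \<in> dom.mball 0 1"
    using zero_V by (simp_all add: G0)
  then obtain r where r: "r > 0" "\<And>h. h \<in> V' \<Longrightarrow> norm_dist V' N' 0 h < r \<Longrightarrow> G h \<in> dom.mball 0 1"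
    using G(1) zero_V(2) unfolding cod.continuous_map_from_metric by meson
  have "N f \<le> 1 / r * N' (T f)" if f: "f \<in> V" for f
  proof (rule homogeneous_bound[OF dom.subspace, where A = "\<lambda>f. N' (T f)"])
    fix f assume f: "f \<in> V" and less: "N' (T f) < r"
    have neg: "N' (0 - T f) = N' (T f)" "N (0 - f) = N f"
    proof -
      have "0 - f = cscale (-1) f" "0 - T f = cscale (-1) (T f)"
        by (simp_all add: cscale_def fun_eq_iff)
      then show "N' (0 - T f) = N' (T f)" "N (0 - f) = N f"
        using dom.norm_cscale[OF f, of "-1"] cod.norm_cscale[OF maps_to[OF f], of "-1"] by simp_all
    qed
    have "norm_dist V' N' 0 (T f) < r"
      using less maps_to[OF f] zero_V neg by (simp add: norm_dist_def)
    from r(2)[OF maps_to[OF f] this] show "N f < 1"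
      using f zero_V neg by (simp add: G(2) norm_dist_def)
  qed (simp_all add: f r(1) dom.norm_nonneg cod.norm_nonneg maps_to dom.norm_cscale T_scale
      cod.norm_cscale)
  then show "T ` V = V' \<and> (\<exists>M. \<forall>f\<in>V. N f \<le> M * N' (T f))"
    using onto by blast
next
  assume *: "T ` V = V' \<and> (\<exists>M. \<forall>f\<in>V. N f \<le> M * N' (T f))"
  then obtain M where M: "\<And>f. f \<in> V \<Longrightarrow> N f \<le> M * N' (T f)" by blast
  have "f = 0" if "f \<in> V" "T f = 0" for f
    using M[OF that(1)] that dom.norm_nonneg[OF that(1)] dom.norm_eq_0_iff[OF that(1)]
    by (simp add: cod.norm_zero)
  then have inj: "inj_on T V"
    by (simp add: inj_on_iff_kernel_trivial)
  define G where "G = inv_into V T"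
  have G: "G h \<in> V" "T (G h) = h" if "h \<in> V'" for h
    using * that by (auto simp: G_def inv_into_into f_inv_into_f)
  have GT: "G (T f) = f" if "f \<in> V" for f
    unfolding G_def using inv_into_f_f[OF inj that] .
  obtain B where B: "B > 0" "\<And>f. f \<in> V \<Longrightarrow> N' (T f) \<le> B * N f"
    by (rule bound_pos) blast
  have "continuous_map (norm_topology V N) (norm_topology V' N') T"
    using B(2) T_diff cfun.subspace_diff[OF dom.subspace]
    by (intro Lipschitz_imp_continuous_map_norm_topology[where C = B]
        dom.normed_function_space_axioms cod.normed_function_space_axioms)
      (auto simp: maps_to simp flip: T_diff)
  moreover have "continuous_map (norm_topology V' N') (norm_topology V N) G"
  proof (intro Lipschitz_imp_continuous_map_norm_topology[where C = M]
        dom.normed_function_space_axioms cod.normed_function_space_axioms)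
    show "N (G h - G k) \<le> M * N' (h - k)" if "h \<in> V'" "k \<in> V'" for h k
      using M[OF cfun.subspace_diff[OF dom.subspace G(1)[OF that(1)] G(1)[OF that(2)]]] that
      by (simp add: T_diff G)
  qed (use G in auto)
  ultimately have "homeomorphic_maps (norm_topology V N) (norm_topology V' N') T G"
    using G GT by (simp add: homeomorphic_maps_def norm_topology_def)
  then show "linear_homeomorphism V N V' N' T"
    using linear homeomorphic_maps_imp_map by (auto simp: linear_homeomorphism_def)
qed

text \<open>
  A lower bound on the adjoint gives surjectivity with controlled preimages, hence an estimate of
  \<open>N f\<close> by \<open>N' (T f)\<close> as soon as preimages are unique. In general a lower bound on the adjoint does
  not make \<open>T\<close> injective (a quotient map has an isometric adjoint), so this is where the
  hypothesis \<open>inj\<close> enters; the adjoint is injective by its lower bound.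
\<close>

theorem adjoint_bounded_from_below_iff:
  assumes complete: "norm_complete V N"
    and inj: "inj_on (adjoint_operator V T) (dual_space V' N') \<Longrightarrow> inj_on T V"
  shows "bounded_from_below (dual_space V' N') (dual_norm V' N') (dual_norm V N)
      (adjoint_operator V T) \<longleftrightarrow> linear_homeomorphism V N V' N' T"
proof
  assume bfb: "bounded_from_below (dual_space V' N') (dual_norm V' N') (dual_norm V N)
      (adjoint_operator V T)"
  then obtain c where c: "c > 0" "\<And>\<phi>. \<phi> \<in> dual_space V' N' \<Longrightarrow>
      c * dual_norm V' N' \<phi> \<le> dual_norm V N (adjoint_operator V T \<phi>)"
    by (auto simp: bounded_from_below_def)
  define M where "M = 1 / c + 1"
  have T_inj: "inj_on T V"
    using inj inj_on_adjoint_if_bounded_from_below[OF bfb] by blast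
  have pre: "\<exists>f\<in>V. T f = g \<and> N f \<le> M * N' g" if "g \<in> V'" for g
    using preimage_if_adjoint_bounded_from_below[OF complete c _ that, of M]
    by (force simp: M_def)
  have "N f \<le> M * N' (T f)" if "f \<in> V" for f
    using pre[OF maps_to[OF that]] inj_onD[OF T_inj] that by metis
  moreover have "T ` V = V'"
    using pre maps_to by blast
  ultimately show "linear_homeomorphism V N V' N' T"
    by (auto simp: linear_homeomorphism_iff)
next
  assume "linear_homeomorphism V N V' N' T"
  then obtain M where onto: "T ` V = V'" and M: "\<And>f. f \<in> V \<Longrightarrow> N f \<le> M * N' (T f)"
    by (auto simp: linear_homeomorphism_iff)
  define M' where "M' = \<bar>M\<bar> + 1"
  have M': "N f \<le> M' * N' (T f)" if "f \<in> V" for f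
    using M[OF that] mult_right_mono[of M M' "N' (T f)"] cod.norm_nonneg[OF maps_to[OF that]]
    unfolding M'_def by linarith
  have "1 / M' * dual_norm V' N' \<phi> \<le> dual_norm V N (adjoint_operator V T \<phi>)"
    if \<phi>: "\<phi> \<in> dual_space V' N'" for \<phi>
  proof -
    let ?d = "dual_norm V N (adjoint_operator V T \<phi>)"
    have d: "0 \<le> ?d"
      using dom.dual_norm_nonneg[OF adjoint_in_dual_space[OF \<phi>]] .
    have "dual_norm V' N' \<phi> \<le> ?d * M'"
    proof (rule cod.dual_norm_le)
      show "cmod (\<phi> g) \<le> ?d * M' * N' g" if "g \<in> V'" for g
      proof -
        from onto \<open>g \<in> V'\<close> obtain f where f: "f \<in> V" "T f = g" by blast
        have "cmod (\<phi> g) \<le> ?d * N f"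
          using dom.dual_norm_bound[OF adjoint_in_dual_space[OF \<phi>] f(1)] f
          by (simp add: adjoint_operator_def)
        also have "\<dots> \<le> ?d * (M' * N' g)"
          using M'[OF f(1)] f(2) d by (intro mult_left_mono) auto
        finally show ?thesis by (simp add: mult.assoc)
      qed
    qed (use d in \<open>simp add: M'_def\<close>)
    then show ?thesis by (simp add: M'_def field_simps)
  qed
  then show "bounded_from_below (dual_space V' N') (dual_norm V' N') (dual_norm V N)
      (adjoint_operator V T)"
    unfolding bounded_from_below_def by (intro exI[of _ "1 / M'"]) (auto simp: M'_def)
qed

text \<open>
  If the adjoint is isometric, the solvability estimate with every constant \<open>M > 1\<close> gives
  \<open>N f \<le> N' (T f)\<close>, and a norming functional for \<open>T f\<close> gives the reverse inequality. Conversely, a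
  surjective isometry maps the unit ball onto the unit ball, so both dual norms are suprema of the
  same set of numbers.
\<close>

theorem adjoint_isometry_iff:
  assumes complete: "norm_complete V N"
    and inj: "inj_on (adjoint_operator V T) (dual_space V' N') \<Longrightarrow> inj_on T V"
  shows "linear_isometry (dual_space V' N') (dual_norm V' N') (dual_norm V N)
      (adjoint_operator V T) \<longleftrightarrow> unitary_operator V N V' N' T"
proof
  assume iso: "linear_isometry (dual_space V' N') (dual_norm V' N') (dual_norm V N)
      (adjoint_operator V T)"
  then have iso': "dual_norm V N (adjoint_operator V T \<phi>) = dual_norm V' N' \<phi>"
    if "\<phi> \<in> dual_space V' N'" for \<phi>
    using that by (simp add: linear_isometry_def)
  have "bounded_from_below (dual_space V' N') (dual_norm V' N') (dual_norm V N)
      (adjoint_operator V T)"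
    unfolding bounded_from_below_def using iso' by (intro exI[of _ 1]) auto
  then have T_inj: "inj_on T V"
    using inj inj_on_adjoint_if_bounded_from_below by blast
  have pre: "\<exists>f\<in>V. T f = g \<and> N f \<le> M * N' g" if "g \<in> V'" "1 < M" for g M
    using preimage_if_adjoint_bounded_from_below[OF complete zero_less_one _ _ that(1), of M]
      iso' that(2) by force
  have almost: "N f \<le> M * N' (T f)" if "f \<in> V" "1 < M" for f M
    using pre[OF maps_to[OF that(1)] that(2)] inj_onD[OF T_inj] that by metis
  have lower: "N f \<le> N' (T f)" if f: "f \<in> V" for f
  proof (rule tendsto_lowerbound)
    show "((\<lambda>M. M * N' (T f)) \<longlongrightarrow> N' (T f)) (at_right 1)"
      by (auto intro!: tendsto_eq_intros)
    show "\<forall>\<^sub>F M in at_right 1. N f \<le> M * N' (T f)"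
      using almost[OF f] by (auto simp: eventually_at_right_field intro: gt_ex)
  qed simp
  have upper: "N' (T f) \<le> N f" if f: "f \<in> V" for f
  proof -
    obtain \<phi> where \<phi>: "\<phi> \<in> dual_space V' N'" "dual_norm V' N' \<phi> \<le> 1" "cmod (\<phi> (T f)) = N' (T f)"
      by (rule cod.norming_functional[OF maps_to[OF f]]) blast
    have "N' (T f) \<le> dual_norm V' N' \<phi> * N f"
      using dom.dual_norm_bound[OF adjoint_in_dual_space[OF \<phi>(1)] f] f \<phi> iso'
      by (simp add: adjoint_operator_def)
    also have "\<dots> \<le> 1 * N f"
      using \<phi>(2) dom.norm_nonneg[OF f] by (rule mult_right_mono)
    finally show ?thesis by simp
  qed
  have "T ` V = V'"
    using pre[of _ 2] maps_to by force
  then show "unitary_operator V N V' N' T"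
    using linear lower upper by (auto simp: unitary_operator_def linear_isometry_def intro: antisym)
next
  assume "unitary_operator V N V' N' T"
  then have onto: "T ` V = V'" and iso: "\<And>f. f \<in> V \<Longrightarrow> N' (T f) = N f"
    by (auto simp: unitary_operator_def linear_isometry_def)
  have "{g \<in> V'. N' g \<le> 1} = T ` {f \<in> V. N f \<le> 1}"
    using onto iso by force
  then have "dual_norm V' N' \<phi> = dual_norm V N (adjoint_operator V T \<phi>)" for \<phi>
    by (simp add: dual_norm_def image_image adjoint_operator_def cong: image_cong_simp)
  then show "linear_isometry (dual_space V' N') (dual_norm V' N') (dual_norm V N)
      (adjoint_operator V T)"
    using adjoint_linear by (simp add: linear_isometry_def)
qed

end

section \<open>Weighted composition operators\<close>

text \<open>
  The singleton \<open>{x}\<close> is compact, so the functions that map it into the unit disc form a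
  neighbourhood of zero in the compact-open topology, and hence contain a ball of the norm.
\<close>

lemma (in nscf) point_evaluation_in_dual_space:
  assumes x: "x \<in> topspace X"
  shows "(\<lambda>f. if f \<in> F then f x else 0) \<in> dual_space F N"
proof -
  define U where "U = {f \<in> continuous_functions X. f ` {x} \<subseteq> ball 0 1}"
  have "openin (compact_open_topology X) U"
    unfolding compact_open_topology_def U_def
    using x by (intro topology_generated_by_Basis) (blast intro: finite_imp_compactin)
  moreover have zero: "0 \<in> F"
    using subspace by (rule cfun.subspace_0)
  moreover from this have "0 \<in> U"
    using subset_continuous by (auto simp: U_def)
  ultimately obtain r where r: "r > 0" "\<And>f. f \<in> F \<Longrightarrow> norm_dist F N 0 f < r \<Longrightarrow> f \<in> U"
    using continuous_inclusion unfolding norm_topology_def continuous_map_from_metric by meson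
  have "cmod (f x) \<le> 1 / r * N f" if "f \<in> F" for f
  proof (rule homogeneous_bound[OF subspace])
    fix f assume f: "f \<in> F" and less: "N f < r"
    have "0 - f = cscale (-1) f"
      by (simp add: cscale_def fun_eq_iff)
    then have "N (0 - f) = N f"
      using norm_cscale[OF f, of "-1"] by simp
    then have "norm_dist F N 0 f < r"
      using f zero less by (simp add: norm_dist_def)
    then show "cmod (f x) < 1"
      using r(2)[OF f] by (simp add: U_def)
  qed (simp_all add: that r(1) norm_nonneg norm_cscale, simp add: cscale_def norm_mult)
  then have "\<exists>C. \<forall>f\<in>F. cmod (f x) \<le> C * N f"
    by blast
  then show ?thesis
    using cfun.subspace_add[OF subspace] cfun.subspace_scale[OF subspace]
    by (auto simp: dual_space_def clinear_on_def cscale_def)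
qed

lemma (in nscf) zero_if_zero_on_dense_set:
  assumes f: "f \<in> F" and dense: "X closure_of A = topspace X" and A: "\<And>x. x \<in> A \<Longrightarrow> f x = 0"
  shows "f = 0"
proof
  fix x
  have cont: "continuous_map X euclidean f" and out: "x \<notin> topspace X \<Longrightarrow> f x = 0"
    using f subset_continuous by (auto simp: continuous_functions_def)
  show "f x = 0 x"
  proof (cases "x \<in> topspace X")
    case True
    then show ?thesis
      using forall_in_closure_of_eq[of x X A euclidean f "\<lambda>_. 0"] dense cont A by simp
  qed (use out in simp)
qed

theorem corollary2p13:
  fixes X :: "'x topology" and Y :: "'y topology"
    and F :: "('x \<Rightarrow> complex) set" and N\<^sub>F :: "('x \<Rightarrow> complex) \<Rightarrow> real"
    and E :: "('y \<Rightarrow> complex) set" and N\<^sub>E :: "('y \<Rightarrow> complex) \<Rightarrow> real"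
    and \<Phi> :: "'y \<Rightarrow> 'x" and \<omega> :: "'y \<Rightarrow> complex"
  defines "W \<equiv> weighted_composition Y \<Phi> \<omega>"
  defines "W_adj \<equiv> adjoint_operator F W"
  assumes F: "nscf X F N\<^sub>F"
    and E: "nscf Y E N\<^sub>E"
    and E_indep: "one_independent Y E"
    and \<Phi>: "\<Phi> \<in> topspace Y \<rightarrow> topspace X"
    and W: "bounded_operator F N\<^sub>F E N\<^sub>E W"
  shows
    "(inj_on W_adj (dual_space E N\<^sub>E) \<longrightarrow> (\<forall>y \<in> topspace Y. \<omega> y \<noteq> 0))
     \<and> (X closure_of (\<Phi> ` topspace Y) = topspace X \<and> inj_on W_adj (dual_space E N\<^sub>E)
          \<longrightarrow> inj_on W F)
     \<and> (norm_complete F N\<^sub>F \<and> norm_complete E N\<^sub>E \<and> X closure_of (\<Phi> ` topspace Y) = topspace X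
          \<longrightarrow> (bounded_from_below (dual_space E N\<^sub>E) (dual_norm E N\<^sub>E) (dual_norm F N\<^sub>F) W_adj
                 \<longleftrightarrow> linear_homeomorphism F N\<^sub>F E N\<^sub>E W)
            \<and> (linear_isometry (dual_space E N\<^sub>E) (dual_norm E N\<^sub>E) (dual_norm F N\<^sub>F) W_adj
                 \<longleftrightarrow> unitary_operator F N\<^sub>F E N\<^sub>E W))"
proof -
  interpret F: nscf X F N\<^sub>F by fact
  interpret E: nscf Y E N\<^sub>E by fact
  interpret bounded_operator_between F N\<^sub>F E N\<^sub>E W
    using W by unfold_locales
  have nonvanishing: "\<omega> y \<noteq> 0"
    if inj: "inj_on W_adj (dual_space E N\<^sub>E)" and y: "y \<in> topspace Y" for y
  proof
    assume "\<omega> y = 0"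
    \<comment> \<open>If \<open>\<omega>\<close> vanishes at \<open>y\<close>, the adjoint annihilates the evaluation at \<open>y\<close>, which is not zero on \<open>E\<close>.\<close>
    define \<delta> where "\<delta> g = (if g \<in> E then g y else 0)" for g
    have \<delta>: "\<delta> \<in> dual_space E N\<^sub>E"
      using E.point_evaluation_in_dual_space[OF y] by (simp add: \<delta>_def[abs_def])
    have "0 \<in> dual_space E N\<^sub>E"
      by (auto simp: dual_space_def clinear_on_def intro!: exI[of _ 0])
    moreover have "W_adj \<delta> = W_adj 0"
      using \<open>\<omega> y = 0\<close>
      by (simp add: W_adj_def adjoint_operator_def W_def weighted_composition_def \<delta>_def fun_eq_iff)
    ultimately have "\<delta> = 0"
      using inj \<delta> by (simp add: inj_onD)
    moreover obtain g where "g \<in> E" "g y \<noteq> 0"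
      using E_indep y by (auto simp: one_independent_def)
    ultimately show False
      by (simp add: \<delta>_def fun_eq_iff) metis
  qed
  have injective: "inj_on W F"
    if dense: "X closure_of (\<Phi> ` topspace Y) = topspace X"
      and inj: "inj_on W_adj (dual_space E N\<^sub>E)"
    unfolding inj_on_iff_kernel_trivial
  proof (intro ballI impI)
    fix f assume f: "f \<in> F" and "W f = 0"
    have "\<omega> y * f (\<Phi> y) = 0" if "y \<in> topspace Y" for y
      using that fun_cong[OF \<open>W f = 0\<close>, of y] by (simp add: W_def weighted_composition_def)
    \<comment> \<open>As \<open>\<omega>\<close> has no zeros, \<open>W f = 0\<close> leaves only \<open>f = 0\<close> on the dense image of \<open>\<Phi>\<close>.\<close>
    then have "f x = 0" if "x \<in> \<Phi> ` topspace Y" for x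
      using that nonvanishing[OF inj] by auto
    then show "f = 0"
      using F.zero_if_zero_on_dense_set[OF f dense] by blast
  qed
  show ?thesis
    using nonvanishing injective adjoint_bounded_from_below_iff adjoint_isometry_iff
    unfolding W_adj_def by blast
qed

end
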